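(* Let $\widehat{\mathcal T} := \mathcal T + \mathcal E \in \bigotimes^p \mathbb R^n$, where $\mathcal T$ is a symmetric tensor with orthogonal decomposition $\mathcal T = \sum_{i=1}^n \lambda_i v_i^{\otimes p}$, $\{v_1, v_2, \dots, v_n\}$ is an orthonormal basis of $\mathbb R^n$, $\lambda_i \neq 0$ for all $i \in [n]$, and $\mathcal E$ is a symmetric tensor with operator norm $\varepsilon := \|\mathcal E\|$. Assume $0 < \theta \le 1/(2\kappa)$ and $\varepsilon \le \theta^2 \lambda_{\min}/12.5$, where $\kappa := \lambda_{\max}/\lambda_{\min}$, $\lambda_{\min} := \min_{i\in[n]} |\lambda_i|$ and $\lambda_{\max} := \max_{i\in[n]} |\lambda_i|$. Let $\{(\hat\lambda_i, \hat v_i)\}_{i\in[n]}$ be the output of the SROAwCD algorithm (successive rank-one approximation with constrained deflation, defined in the context) for the input $(\widehat{\mathcal T}, \theta)$. Then there exists a permutation $\pi$ of $[n]$ such that for all $j \in [n]$, $$\min\left\{ |\lambda_{\pi(j)} - \hat\lambda_j|,\ |\lambda_{\pi(j)} + \hat\lambda_j| \right\} \le \varepsilon,$$ $$\min\left\{ \|v_{\pi(j)} - \hat v_j\|,\ \|v_{\pi(j)} + \hat v_j\| \right\} \le \frac{(6.2 + 4\kappa)\,\varepsilon}{|\lambda_{\pi(j)}|}.$$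
   Context: Notation: $[n] = \{1,\dots,n\}$. $\bigotimes^p \mathbb R^n = \mathbb R^{n\times\cdots\times n}$ ($p$ factors) is the space of real $p$-way $n$-dimensional tensors $\mathcal A = (\mathcal A_{i_1,\dots,i_p})$. A tensor is symmetric if its entries are invariant under every permutation of the $p$ indices. For $v \in \mathbb R^n$, $v^{\otimes p}$ is the tensor with entries $(v^{\otimes p})_{i_1,\dots,i_p} = v_{i_1} \cdots v_{i_p}$. The $\lambda_i$ are real. For vectors, $\langle\cdot,\cdot\rangle$ and $\|\cdot\|$ are the Euclidean inner product and norm. For tensors, $\|\mathcal A\|_F = \big(\sum_{i_1,\dots,i_p} \mathcal A_{i_1,\dots,i_p}^2\big)^{1/2}$ is the Frobenius norm and $\|\mathcal A\| = \max_{\|x_1\|=\cdots=\|x_p\|=1} \sum_{i_1,\dots,i_p} \mathcal A_{i_1,\dots,i_p} (x_1)_{i_1}\cdots (x_p)_{i_p}$ is the operator norm (for symmetric $\mathcal A$ it equals $\max_{\|x\|=1} \big|\sum_{i_1,\dots,i_p} \mathcal A_{i_1,\dots,i_p} x_{i_1}\cdots x_{i_p}\big|$). SROAwCD algorithm. Input: a symmetric $p$-way tensor $\widehat{\mathcal T} \in \bigotimes^p \mathbb R^n$ and a parameter $\theta > 0$. Initialize $\hat v_0 = 0$. For $k = 1, 2, \dots, n$ in turn, let $(\hat\lambda_k, \hat v_k)$ be a minimizer of $$\min_{\lambda \in \mathbb R,\ v \in \mathbb R^n} \ \|\widehat{\mathcal T} - \lambda v^{\otimes p}\|_F \quad \text{subject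 to} \quad \|v\| = 1, \quad -\theta \le \langle v, \hat v_i\rangle \le \theta \ \text{ for } i = 0, 1, \dots, k-1.$$ Output: $\{(\hat\lambda_k, \hat v_k)\}_{k=1}^n$.
   Formalization: The order p of the tensors is assumed to be at least 3; the claim as stated fails for p = 2 (T the identity on R^2, E = 0, where any unit vector may be output first) and for p = 1 (T = v_1 + v_2, E = 0). *)

theory Defs
  imports "HOL-Analysis.Analysis" "HOL-Combinatorics.Permutations"
begin

text \<open>
  A real \<open>p\<close>-way \<open>n\<close>-dimensional tensor is a vector whose coordinates are the multi-indices
  \<open>(i\<^sub>1, \<dots>, i\<^sub>p)\<close>, i.e. the functions \<open>'p \<Rightarrow> 'n\<close>, with \<open>p = CARD('p)\<close> and \<open>n = CARD('n)\<close>.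
  With this choice the library \<^const>\<open>norm\<close> on tensors is the Frobenius norm.
\<close>

type_synonym ('p, 'n) tensor = "(real, 'p \<Rightarrow> 'n) vec"

lemma norm_tensor_eq_frobenius:
  fixes A :: "('p::finite, 'n::finite) tensor"
  shows "norm A = sqrt (\<Sum>i\<in>UNIV. (A $ i)\<^sup>2)"
  by (simp add: norm_vec_def L2_set_def)

definition symmetric_tensor :: "('p::finite, 'n::finite) tensor \<Rightarrow> bool" where
  "symmetric_tensor A \<longleftrightarrow> (\<forall>\<sigma>. bij \<sigma> \<longrightarrow> (\<forall>i. A $ (i \<circ> \<sigma>) = A $ i))"

definition tensor_power :: "real ^ 'n \<Rightarrow> ('p::finite, 'n::finite) tensor" where
  "tensor_power v = (\<chi> i. \<Prod>k\<in>UNIV. v $ i k)"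

definition tensor_form :: "('p::finite, 'n::finite) tensor \<Rightarrow> ('p \<Rightarrow> real ^ 'n) \<Rightarrow> real" where
  "tensor_form A x = (\<Sum>i\<in>UNIV. A $ i * (\<Prod>k\<in>UNIV. x k $ i k))"

definition tensor_op_norm :: "('p::finite, 'n::finite) tensor \<Rightarrow> real" where
  "tensor_op_norm A = (SUP x\<in>{x. \<forall>k. norm (x k) = 1}. tensor_form A x)"

text \<open>The supremum is a maximum.\<close>

lemma tensor_op_norm_attained:
  fixes A :: "('p::finite, 'n::finite) tensor"
  shows "\<exists>x. (\<forall>k. norm (x k) = 1) \<and> tensor_form A x = tensor_op_norm A \<and>
    (\<forall>y. (\<forall>k. norm (y k) = 1) \<longrightarrow> tensor_form A y \<le> tensor_form A x)"
proof -
  define S where "S = {x :: (real ^ 'n) ^ 'p. \<forall>k. norm (x $ k) = 1}"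
  have "norm x \<le> real CARD('p)" if "x \<in> S" for x
    using norm_le_l1_cart[of "\<chi> k. norm (x $ k)"] that
    by (simp add: S_def norm_vec_def L2_set_def)
  then have "bounded S"
    by (auto simp: bounded_iff)
  moreover have "closed S"
    unfolding S_def by (intro closed_Collect_all closed_Collect_eq continuous_intros)
  ultimately have "compact S"
    by (simp add: compact_eq_bounded_closed)
  moreover have "(\<chi> k. axis undefined 1) \<in> S"
    by (simp add: S_def)
  moreover have "continuous_on S (\<lambda>x. tensor_form A (($) x))"
    unfolding tensor_form_def by (intro continuous_intros)
  ultimately obtain m where m: "m \<in> S" "\<And>y. y \<in> S \<Longrightarrow> tensor_form A (($) y) \<le> tensor_form A (($) m)"
    using continuous_attains_sup[of S "\<lambda>x. tensor_form A (($) x)"] by blast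
  have le: "tensor_form A y \<le> tensor_form A (($) m)" if "\<forall>k. norm (y k) = 1" for y
    using m(2)[of "\<chi> k. y k"] that by (simp add: S_def vec_lambda_inverse)
  have "tensor_op_norm A = tensor_form A (($) m)"
    unfolding tensor_op_norm_def
    by (rule cSup_eq_maximum) (use le m(1) in \<open>auto simp: S_def\<close>)
  then show ?thesis
    using le m(1) by (intro exI[of _ "($) m"]) (auto simp: S_def)
qed

definition orthonormal_basis :: "(nat \<Rightarrow> real ^ 'n::finite) \<Rightarrow> bool" where
  "orthonormal_basis v \<longleftrightarrow>
     (\<forall>i\<in>{1..CARD('n)}. \<forall>j\<in>{1..CARD('n)}. v i \<bullet> v j = (if i = j then 1 else 0)) \<and>
     span (v ` {1..CARD('n)}) = UNIV"

text \<open>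
  The minimizers of successive rank-one approximation with constrained deflation need not be
  unique, so its output is a relation: it holds for every sequence of pairs that some choice of
  minimizers can produce. Only the values at \<open>1, \<dots>, n\<close> are output; \<open>v_hat 0 = 0\<close> is the
  initialization.
\<close>

definition SROAwCD_output ::
    "('p::finite, 'n::finite) tensor \<Rightarrow> real \<Rightarrow> (nat \<Rightarrow> real) \<Rightarrow> (nat \<Rightarrow> real ^ 'n) \<Rightarrow> bool" where
  "SROAwCD_output T_hat \<theta> lam_hat v_hat \<longleftrightarrow>
     v_hat 0 = 0 \<and>
     (\<forall>k\<in>{1..CARD('n)}.
        is_arg_min (\<lambda>(l, v). norm (T_hat - l *\<^sub>R tensor_power v))
          (\<lambda>(l, v). norm v = 1 \<and> (\<forall>i<k. -\<theta> \<le> v \<bullet> v_hat i \<and> v \<bullet> v_hat i \<le> \<theta>))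
          (lam_hat k, v_hat k))"

end

theory Submission
  imports Defs
begin

text \<open>
  A rank-one fit by unit vectors maximizes the absolute value of the form
  \<open>F x = tensor_form (T + E) (\<lambda>_. x)\<close> over the feasible unit vectors. Basis vectors that
  are not yet matched are feasible at step \<open>k\<close>, while the matched ones have inner product
  of order \<open>\<theta>\<close> with \<open>y = v_hat k\<close>, too small to contribute to \<open>F y\<close>. Hence a single
  unmatched index \<open>j\<close> carries almost all of \<open>y\<close>; this gives the eigenvalue bound.

  For the linear bound on the distance no stationarity condition is needed: with \<open>w = v j\<close>
  or \<open>w = - v j\<close> on the side of \<open>y\<close>, \<open>\<bar>F w\<bar> \<le> \<bar>F y\<bar>\<close> bounds the loss of order
  \<open>p * \<bar>lam j\<bar> * (norm (y - w))\<^sup>2\<close> in the form of \<open>T\<close> by the gain in the form of \<open>E\<close>,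
  which is at most \<open>p * \<epsilon> * norm (y - w)\<close> by multilinearity. The resulting bound
  \<open>3 * \<epsilon> / \<bar>lam j\<bar>\<close> is at most \<open>0.12 * \<theta>\<close>, which keeps the induction going.
\<close>

section \<open>Multilinear forms, the operator norm, and rank-one fits\<close>

lemma tensor_form_scaleR:
  "tensor_form A (\<lambda>k. c k *\<^sub>R x k) = (\<Prod>k\<in>UNIV. c k) * tensor_form A x"
  by (simp add: tensor_form_def prod.distrib sum_distrib_left mult_ac)

lemma tensor_form_upd_diff:
  "tensor_form A (x(k := y - z)) = tensor_form A (x(k := y)) - tensor_form A (x(k := z))"
proof -
  have "(\<Prod>l\<in>UNIV. (x(k := u)) l $ i l) = u $ i k * (\<Prod>l\<in>UNIV - {k}. x l $ i l)" for u i
    by (subst prod.remove[of _ k]) (auto intro!: prod.cong)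
  then show ?thesis
    by (simp only: tensor_form_def) (simp add: algebra_simps flip: sum_subtractf)
qed

lemma tensor_form_add_left: "tensor_form (A + B) x = tensor_form A x + tensor_form B x"
  by (simp add: tensor_form_def algebra_simps sum.distrib)

lemma inner_tensor_power: "A \<bullet> tensor_power x = tensor_form A (\<lambda>_. x)"
  by (simp add: tensor_form_def tensor_power_def inner_vec_def)

lemma tensor_power_inner_tensor_power:
  "(tensor_power x :: ('p::finite, 'n::finite) tensor) \<bullet> tensor_power y = (x \<bullet> y) ^ CARD('p)"
proof -
  \<comment> \<open>Distributing a product of equal sums, one for each slot, gives a sum over all
    multi-indices.\<close>
  have "(\<Prod>k\<in>(UNIV :: 'p set). \<Sum>j\<in>UNIV. x $ j * y $ j)
      = (\<Sum>i\<in>UNIV. \<Prod>k\<in>(UNIV :: 'p set). x $ i k * y $ i k)"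
    by (subst prod_sum_PiE) (auto simp: PiE_def)
  then show ?thesis
    by (simp add: tensor_power_def inner_vec_def prod.distrib)
qed

lemma abs_tensor_form_le_unit:
  fixes A :: "('p::finite, 'n::finite) tensor"
  assumes "\<And>k. norm (x k) = 1"
  shows "\<bar>tensor_form A x\<bar> \<le> tensor_op_norm A"
proof -
  have le: "tensor_form A y \<le> tensor_op_norm A" if "\<And>k. norm (y k) = 1" for y
    using tensor_op_norm_attained[of A] that by metis
  \<comment> \<open>Negating the vector in one slot flips the sign of the form, so the upper bound
    also holds for the absolute value. Here \<open>undefined\<close> is just some fixed
    slot.\<close>
  define c :: "'p \<Rightarrow> real" where "c = (\<lambda>k. if k = undefined then - 1 else 1)"
  have "- tensor_form A x = tensor_form A (\<lambda>k. c k *\<^sub>R x k)"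
    by (simp add: tensor_form_scaleR c_def)
  also have "\<dots> \<le> tensor_op_norm A"
    by (rule le) (simp add: c_def assms)
  finally show ?thesis
    using le[of x, OF assms] by linarith
qed

lemma abs_tensor_form_le:
  fixes A :: "('p::finite, 'n::finite) tensor"
  shows "\<bar>tensor_form A x\<bar> \<le> tensor_op_norm A * (\<Prod>k\<in>UNIV. norm (x k))"
proof -
  \<comment> \<open>A zero vector has no direction, so any unit vector serves; the factor
    \<open>norm (x k) = 0\<close> makes the choice irrelevant.\<close>
  define u where "u k = (if x k = 0 then axis undefined 1 else sgn (x k))" for k
  have "x = (\<lambda>k. norm (x k) *\<^sub>R u k)"
    by (auto simp: u_def sgn_div_norm)
  then have "tensor_form A x = (\<Prod>k\<in>UNIV. norm (x k)) * tensor_form A u"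
    by (metis tensor_form_scaleR)
  moreover have "\<bar>tensor_form A u\<bar> \<le> tensor_op_norm A"
    by (rule abs_tensor_form_le_unit) (simp add: u_def norm_sgn)
  ultimately show ?thesis
    by (simp add: abs_mult prod_nonneg abs_prod mult.commute mult_right_mono)
qed

lemma tensor_op_norm_nonneg: "0 \<le> tensor_op_norm A"
  using abs_tensor_form_le_unit[of "\<lambda>_. axis undefined 1" A] by simp

text \<open>Telescoping: the slots are switched from \<open>y\<close> to \<open>x\<close> one at a
  time. By linearity in the switched slot, each switch changes the form by its value with
  \<open>x - y\<close> there and unit vectors elsewhere.\<close>

lemma abs_tensor_form_diff_le:
  fixes A :: "('p::finite, 'n::finite) tensor"
  assumes "norm x = 1" "norm y = 1"
  shows "\<bar>tensor_form A (\<lambda>_. x) - tensor_form A (\<lambda>_. y)\<bar>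
    \<le> CARD('p) * tensor_op_norm A * norm (x - y)"
proof -
  define h where "h S = (\<lambda>k. if k \<in> S then x else y)" for S :: "'p set"
  have "\<bar>tensor_form A (h S) - tensor_form A (h {})\<bar> \<le> card S * tensor_op_norm A * norm (x - y)"
    for S
    using finite[of S]
  proof (induction S rule: finite_induct)
    case (insert k S)
    have "h (insert k S) = (h S)(k := x)" "h S = (h S)(k := y)"
      using insert.hyps by (auto simp: h_def)
    then have "tensor_form A (h (insert k S)) - tensor_form A (h S)
        = tensor_form A ((h S)(k := x - y))"
      by (metis tensor_form_upd_diff)
    moreover have "(\<Prod>l\<in>UNIV. norm (((h S)(k := x - y)) l)) = norm (x - y)"
      by (subst prod.remove[of _ k])
         (simp_all add: h_def assms if_distrib[of norm] cong: if_cong)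
    ultimately have "\<bar>tensor_form A (h (insert k S)) - tensor_form A (h S)\<bar>
        \<le> tensor_op_norm A * norm (x - y)"
      using abs_tensor_form_le[of A "(h S)(k := x - y)"] by simp
    then show ?case
      using insert by (simp add: algebra_simps)
  qed simp
  from this[of UNIV] show ?thesis
    by (simp add: h_def)
qed

text \<open>The power of a unit vector is a unit tensor, so the squared error is
  \<open>(norm A)\<^sup>2 - (?f x)\<^sup>2 + (l - ?f x)\<^sup>2\<close>. The best coefficient is
  therefore \<open>?f x\<close>, and the best direction maximizes the absolute value of the
  form.\<close>

lemma SROAwCD_output_maximizes:
  fixes A :: "('p::finite, 'n::finite) tensor"
  assumes "SROAwCD_output A \<theta> lam_hat v_hat" and k: "k \<in> {1..CARD('n)}"
  shows "norm (v_hat k) = 1"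
    and "i < k \<Longrightarrow> \<bar>v_hat k \<bullet> v_hat i\<bar> \<le> \<theta>"
    and "lam_hat k = tensor_form A (\<lambda>_. v_hat k)"
    and "\<lbrakk>norm x = 1; \<And>i. i < k \<Longrightarrow> \<bar>x \<bullet> v_hat i\<bar> \<le> \<theta>\<rbrakk>
      \<Longrightarrow> \<bar>tensor_form A (\<lambda>_. x)\<bar> \<le> \<bar>tensor_form A (\<lambda>_. v_hat k)\<bar>"
proof -
  let ?f = "\<lambda>x. tensor_form A (\<lambda>_. x)"
  let ?P = "\<lambda>x. norm x = 1 \<and> (\<forall>i<k. - \<theta> \<le> x \<bullet> v_hat i \<and> x \<bullet> v_hat i \<le> \<theta>)"
  have run: "is_arg_min (\<lambda>(l, v). norm (A - l *\<^sub>R tensor_power v)) (\<lambda>(l, v). ?P v) (lam_hat k, v_hat k)"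
    using assms by (simp add: SROAwCD_output_def)
  then have P: "?P (v_hat k)"
    by (simp add: is_arg_min_def)
  then show unit: "norm (v_hat k) = 1" and "i < k \<Longrightarrow> \<bar>v_hat k \<bullet> v_hat i\<bar> \<le> \<theta>"
    by (auto simp: abs_le_iff)
  have sq: "(norm (A - l *\<^sub>R tensor_power x))\<^sup>2 = (norm A)\<^sup>2 - (?f x)\<^sup>2 + (l - ?f x)\<^sup>2"
    if "norm x = 1" for l x
  proof -
    have "(tensor_power x :: ('p, 'n) tensor) \<bullet> tensor_power x = 1"
      using that unfolding tensor_power_inner_tensor_power norm_eq_1 by simp
    then have "norm (tensor_power x :: ('p, 'n) tensor) = 1"
      by (simp only: norm_eq_1)
    then have norm_sq: "(norm (l *\<^sub>R tensor_power x :: ('p, 'n) tensor))\<^sup>2 = l\<^sup>2"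
      by simp
    have form: "A \<bullet> (l *\<^sub>R tensor_power x) = l * ?f x"
      by (simp only: inner_scaleR_right inner_tensor_power)
    have "2 * (l * ?f x) = (norm A)\<^sup>2 + l\<^sup>2 - (norm (A - l *\<^sub>R tensor_power x))\<^sup>2"
      using dot_norm_neg[of A "l *\<^sub>R tensor_power x"] unfolding form norm_sq by simp
    then show ?thesis
      by (simp add: power2_diff)
  qed
  have le: "- (?f (v_hat k))\<^sup>2 + (lam_hat k - ?f (v_hat k))\<^sup>2 \<le> - (?f x)\<^sup>2 + (l - ?f x)\<^sup>2"
    if "?P x" for l x
  proof -
    have "\<forall>a b. \<not> (?P b \<and>
        norm (A - a *\<^sub>R tensor_power b) < norm (A - lam_hat k *\<^sub>R tensor_power (v_hat k)))"
      using run unfolding is_arg_min_def not_ex split_paired_All prod.case by (rule conjunct2)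
    then have "norm (A - lam_hat k *\<^sub>R tensor_power (v_hat k)) \<le> norm (A - l *\<^sub>R tensor_power x)"
      using that by (metis not_less)
    then have "(norm (A - lam_hat k *\<^sub>R tensor_power (v_hat k)))\<^sup>2 \<le> (norm (A - l *\<^sub>R tensor_power x))\<^sup>2"
      by (rule power_mono) simp
    then show ?thesis
      using sq[OF unit, of "lam_hat k"] sq[of x l] that by linarith
  qed
  \<comment> \<open>Keeping the vector and changing only the coefficient forces the square
    \<open>(lam_hat k - ?f (v_hat k))\<^sup>2\<close> to vanish.\<close>
  show eq: "lam_hat k = ?f (v_hat k)"
    using le[OF P, of "?f (v_hat k)"] by simp
  show "\<bar>?f x\<bar> \<le> \<bar>?f (v_hat k)\<bar>" if "norm x = 1" "\<And>i. i < k \<Longrightarrow> \<bar>x \<bullet> v_hat i\<bar> \<le> \<theta>"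
  proof -
    have "?P x"
      using that by (auto simp: abs_le_iff minus_le_iff)
    from le[OF this, of "?f x"] show ?thesis
      by (simp add: eq abs_le_square_iff)
  qed
qed

section \<open>Coordinates in the orthonormal basis and scalar estimates\<close>

lemma tensor_form_sum_powers:
  fixes v :: "'i \<Rightarrow> real ^ 'n"
  assumes "T = (\<Sum>i\<in>I. lam i *\<^sub>R (tensor_power (v i) :: ('p::finite, 'n::finite) tensor))"
  shows "tensor_form T (\<lambda>_. x) = (\<Sum>i\<in>I. lam i * (v i \<bullet> x) ^ CARD('p))"
  by (simp add: assms inner_sum_left tensor_power_inner_tensor_power flip: inner_tensor_power)

lemma orthonormal_basis_parseval:
  fixes v :: "nat \<Rightarrow> real ^ 'n::finite"
  assumes "orthonormal_basis v"
  shows "(\<Sum>i=1..CARD('n). (v i \<bullet> x)\<^sup>2) = (norm x)\<^sup>2"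
proof -
  let ?I = "{1..CARD('n)}"
  have on: "v i \<bullet> v j = (if i = j then 1 else 0)" if "i \<in> ?I" "j \<in> ?I" for i j
    using assms that by (simp add: orthonormal_basis_def)
  have inj: "inj_on v ?I"
    using on by (intro inj_onI) (metis zero_neq_one)
  have "(\<Sum>u\<in>v ` ?I. (x \<bullet> u) *\<^sub>R u) = x"
    using assms on
    by (intro orthonormal_basis_expand)
       (auto simp: pairwise_def orthogonal_def orthonormal_basis_def norm_eq_1)
  then have "x \<bullet> x = x \<bullet> (\<Sum>i\<in>?I. (x \<bullet> v i) *\<^sub>R v i)"
    using inj by (simp add: sum.reindex)
  then show ?thesis
    unfolding power2_norm_eq_inner
    by (simp add: inner_sum_right power2_eq_square inner_commute)
qed

text \<open>Two of the \<open>p\<close> factors are split off as a square, so that Parseval can be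
  applied to what remains.\<close>

lemma sum_abs_power_le:
  fixes lam x :: "'i \<Rightarrow> real"
  assumes "2 \<le> p" and "\<And>i. i \<in> I \<Longrightarrow> \<bar>lam i\<bar> * \<bar>x i\<bar> ^ (p - 2) \<le> M"
  shows "(\<Sum>i\<in>I. \<bar>lam i\<bar> * \<bar>x i\<bar> ^ p) \<le> M * (\<Sum>i\<in>I. (x i)\<^sup>2)"
proof -
  have "\<bar>lam i\<bar> * \<bar>x i\<bar> ^ p \<le> M * (x i)\<^sup>2" if "i \<in> I" for i
  proof -
    have "\<bar>x i\<bar> ^ p = \<bar>x i\<bar> ^ (p - 2) * (x i)\<^sup>2"
      using assms(1) by (metis le_add_diff_inverse2 power2_abs power_add)
    then show ?thesis
      using mult_right_mono[OF assms(2)[OF that], of "(x i)\<^sup>2"] by (simp add: mult_ac)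
  qed
  then show ?thesis
    by (simp add: sum_distrib_left sum_mono)
qed

lemma power_le_self_real:
  fixes a :: real
  assumes "0 \<le> a" "a \<le> 1" "1 \<le> n"
  shows "a ^ n \<le> a"
  using power_decreasing[of 1 n a] assms by simp

text \<open>The squares \<open>(x i)\<^sup>2\<close> act as weights of total mass one, so
  \<open>S I p\<close> is at most the largest
  \<open>\<bar>lam i\<bar> * \<bar>x i\<bar> ^ (p - 2)\<close>. Indices in \<open>J\<close> stay
  below \<open>B < S I p\<close>, hence an index outside \<open>J\<close> must reach
  \<open>S I p\<close>.\<close>

lemma dominant_coordinate:
  fixes lam x :: "'i \<Rightarrow> real"
  defines "S \<equiv> \<lambda>I p. \<Sum>i\<in>I. \<bar>lam i\<bar> * \<bar>x i\<bar> ^ p"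
  assumes "finite I" "2 \<le> p" "(\<Sum>i\<in>I. (x i)\<^sup>2) = 1" "I - J \<noteq> {}"
    and J: "\<And>i. i \<in> J \<Longrightarrow> \<bar>lam i\<bar> * \<bar>x i\<bar> ^ (p - 2) \<le> B"
    and S: "\<And>i. i \<in> I - J \<Longrightarrow> B < S I p"
  obtains j where "j \<in> I - J" "S I p \<le> \<bar>lam j\<bar> * \<bar>x j\<bar> ^ (p - 2)"
proof -
  define f where "f i = \<bar>lam i\<bar> * \<bar>x i\<bar> ^ (p - 2)" for i
  have fin: "finite (f ` (I - J))" and ne: "f ` (I - J) \<noteq> {}"
    using assms by auto
  obtain j where j: "j \<in> I - J" "f j = Max (f ` (I - J))"
    using Max_in[OF fin ne] by (metis imageE)
  have "f i \<le> max (f j) B" if "i \<in> I" for i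
  proof (cases "i \<in> J")
    case True
    then show ?thesis using J[of i] by (simp add: f_def le_max_iff_disj)
  next
    case False
    then have "f i \<le> f j"
      unfolding j(2) using fin that by (intro Max_ge) auto
    then show ?thesis by simp
  qed
  then have "S I p \<le> max (f j) B"
    using sum_abs_power_le[of p I lam x "max (f j) B"] assms by (simp add: f_def)
  with S[OF j(1)] have "S I p \<le> f j"
    by linarith
  with j(1) that show thesis
    by (simp add: f_def)
qed

text \<open>In the factorization of \<open>1 - a ^ n\<close> by \<open>1 - a\<close>, each of the
  \<open>n\<close> terms of the geometric sum is at least \<open>a ^ (n - 1)\<close>.\<close>

lemma one_minus_power_ge:
  fixes a :: real
  assumes "0 \<le> a" "a \<le> 1"
  shows "real n * a ^ (n - 1) * (1 - a) \<le> 1 - a ^ n"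
proof -
  have "real n * a ^ (n - 1) = (\<Sum>i<n. a ^ (n - 1))"
    by simp
  also have "\<dots> \<le> (\<Sum>i<n. a ^ i)"
    using assms by (intro sum_mono power_decreasing) auto
  finally show ?thesis
    using assms by (simp add: one_diff_power_eq mult.commute mult_left_mono)
qed

text \<open>Here \<open>t\<close> is the signed eigenvalue, \<open>a\<close> the inner product of
  \<open>y\<close> and \<open>w\<close>, \<open>\<delta>\<close> their distance, \<open>r\<close>
  the contribution of the other coordinates, and \<open>ex\<close>, \<open>ey\<close> the
  perturbation at \<open>w\<close> and \<open>y\<close>. The loss is at least
  \<open>0.46 * p * \<bar>t\<bar> * \<delta>\<^sup>2\<close>; \<open>r\<close> returns at most
  \<open>0.1 * p * \<bar>t\<bar> * \<delta>\<^sup>2\<close> and the perturbation at most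
  \<open>p * \<epsilon> * \<delta>\<close>. The factor \<open>p\<close> cancels, leaving
  \<open>0.36 * \<bar>t\<bar> * \<delta> \<le> \<epsilon>\<close>.\<close>

lemma distance_bound:
  fixes t a \<delta> \<epsilon> r ex ey :: real
  assumes p: "3 \<le> p" and a: "0 \<le> a" "a \<le> 1" and \<delta>: "0 \<le> \<delta>" "\<delta>\<^sup>2 = 2 - 2 * a"
    and a_pow: "0.96 \<le> a ^ (p - 2)"
    and \<epsilon>: "0 \<le> \<epsilon>" "\<epsilon> \<le> \<bar>t\<bar> / 50" and t: "t \<noteq> 0"
    and e_diff: "\<bar>ey - ex\<bar> \<le> real p * \<epsilon> * \<delta>" and ex: "\<bar>ex\<bar> \<le> \<epsilon>"
    and r: "\<bar>r\<bar> \<le> 0.3 * \<bar>t\<bar> * (1 - a\<^sup>2)"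
    and le: "\<bar>t + ex\<bar> \<le> \<bar>t * a ^ p + r + ey\<bar>"
  shows "\<delta> \<le> 3 * \<epsilon> / \<bar>t\<bar>"
proof -
  have a96: "0.96 \<le> a"
    using a_pow power_le_self_real[OF a, of "p - 2"] p by linarith
  have "0.96 * 0.96 \<le> a ^ (p - 2) * a"
    using a_pow a96 by (intro mult_mono) auto
  then have a_p1: "0.92 \<le> a ^ (p - 1)"
    using p power_minus_mult[of "p - 1" a] by (simp add: numeral_eq_Suc)
  have "0.92 * 0.96 \<le> a ^ (p - 1) * a"
    using a_p1 a96 by (intro mult_mono) auto
  moreover have "a ^ (p - 1) * a = a ^ p"
    using p by (intro power_minus_mult) simp
  ultimately have a_p: "0.88 \<le> a ^ p" "a ^ p \<le> 1"
    using a by (auto simp: power_le_one)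
  have tap: "\<epsilon> \<le> \<bar>t\<bar> * a ^ p"
    using mult_left_mono[OF a_p(1), of "\<bar>t\<bar>"] \<epsilon> by simp
  \<comment> \<open>As \<open>\<bar>ex\<bar> \<le> \<epsilon> \<le> \<bar>t\<bar> * a ^ p\<close>,
    adding \<open>ex\<close> reverses the sign of neither \<open>t\<close> nor
    \<open>t * a ^ p\<close>, so \<open>ex\<close> cancels in the difference.\<close>
  have "\<bar>t\<bar> * (1 - a ^ p) \<le> \<bar>t + ex\<bar> - \<bar>t * a ^ p + ex\<bar>"
  proof (cases "t \<ge> 0")
    case True
    then show ?thesis using tap ex \<epsilon> by (simp add: algebra_simps)
  next
    case False
    then show ?thesis using tap ex \<epsilon> by (simp add: algebra_simps)
  qed
  also have "\<dots> \<le> \<bar>r\<bar> + \<bar>ey - ex\<bar>"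
    using le by linarith
  finally have upper: "\<bar>t\<bar> * (1 - a ^ p) \<le> 0.3 * \<bar>t\<bar> * (1 - a\<^sup>2) + real p * \<epsilon> * \<delta>"
    using r e_diff by linarith
  have "real p * 0.92 * (1 - a) \<le> real p * a ^ (p - 1) * (1 - a)"
    using a_p1 a by (intro mult_right_mono mult_left_mono) auto
  also have "\<dots> \<le> 1 - a ^ p"
    by (rule one_minus_power_ge[OF a])
  finally have "real p * 0.46 * \<delta>\<^sup>2 \<le> 1 - a ^ p"
    by (simp add: \<delta> field_simps)
  then have "\<bar>t\<bar> * (real p * 0.46 * \<delta>\<^sup>2) \<le> \<bar>t\<bar> * (1 - a ^ p)"
    by (rule mult_left_mono) simp
  moreover have "0.3 * \<bar>t\<bar> * (1 - a\<^sup>2) \<le> 0.1 * real p * \<bar>t\<bar> * \<delta>\<^sup>2"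
  proof -
    \<comment> \<open>The difference of the two sides is \<open>(1 - a)\<^sup>2\<close>.\<close>
    have "1 - a\<^sup>2 \<le> \<delta>\<^sup>2"
      using zero_le_power2[of "1 - a"] \<delta> by (simp add: power2_eq_square algebra_simps)
    then have "0.3 * (1 - a\<^sup>2) \<le> 0.3 * \<delta>\<^sup>2"
      by simp
    also have "\<dots> \<le> 0.1 * real p * \<delta>\<^sup>2"
      using p by (intro mult_right_mono) auto
    finally have "\<bar>t\<bar> * (0.3 * (1 - a\<^sup>2)) \<le> \<bar>t\<bar> * (0.1 * real p * \<delta>\<^sup>2)"
      by (rule mult_left_mono) simp
    then show ?thesis by (simp add: mult_ac)
  qed
  ultimately have "\<bar>t\<bar> * (real p * 0.46 * \<delta>\<^sup>2) \<le> 0.1 * real p * \<bar>t\<bar> * \<delta>\<^sup>2 + real p * \<epsilon> * \<delta>"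
    using upper by linarith
  moreover have "\<bar>t\<bar> * (real p * 0.46 * \<delta>\<^sup>2)
      = 0.1 * real p * \<bar>t\<bar> * \<delta>\<^sup>2 + real p * (0.36 * \<bar>t\<bar> * \<delta>\<^sup>2)"
    by simp
  ultimately have "real p * (0.36 * \<bar>t\<bar> * \<delta>\<^sup>2) \<le> real p * (\<epsilon> * \<delta>)"
    by (simp only: mult.assoc add_le_cancel_left)
  then have "(0.36 * \<bar>t\<bar> * \<delta>) * \<delta> \<le> \<epsilon> * \<delta>"
    using p by (simp add: power2_eq_square)
  then have "0.36 * \<bar>t\<bar> * \<delta> \<le> \<epsilon> \<or> \<delta> = 0"
    using \<delta>(1) by auto
  then have "\<bar>t\<bar> * \<delta> \<le> 3 * \<epsilon>"
    using \<epsilon> by auto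
  then show ?thesis
    using t by (simp add: field_simps)
qed

section \<open>One step of the deflation\<close>

text \<open>\<open>J\<close> stands for the indices matched earlier. The bound
  \<open>1.12 * \<theta>\<close> combines the constraint \<open>\<theta>\<close> against earlier
  outputs with their error \<open>0.12 * \<theta>\<close>. The maximality of \<open>y\<close> is
  used only against the unmatched basis vectors.\<close>

lemma constrained_maximizer_near_basis:
  fixes T E :: "('p::finite, 'n::finite) tensor" and v :: "nat \<Rightarrow> real ^ 'n"
  assumes p: "3 \<le> CARD('p)"
    and T: "T = (\<Sum>i=1..CARD('n). lam i *\<^sub>R tensor_power (v i))"
    and basis: "orthonormal_basis v"
    and m: "0 < m" "\<And>i. i \<in> {1..CARD('n)} \<Longrightarrow> m \<le> \<bar>lam i\<bar>"
    and K: "\<And>i. i \<in> {1..CARD('n)} \<Longrightarrow> \<bar>lam i\<bar> \<le> K"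
    and \<theta>: "0 < \<theta>" "\<theta> \<le> 1 / 2" "K * \<theta> \<le> m / 2"
    and E: "tensor_op_norm E \<le> \<theta>\<^sup>2 * m / 12.5"
    and J: "J \<subset> {1..CARD('n)}" "\<And>i. i \<in> J \<Longrightarrow> \<bar>v i \<bullet> y\<bar> \<le> 1.12 * \<theta>"
    and y: "norm y = 1"
    and max: "\<And>i. i \<in> {1..CARD('n)} - J \<Longrightarrow>
      \<bar>tensor_form (T + E) (\<lambda>_. v i)\<bar> \<le> \<bar>tensor_form (T + E) (\<lambda>_. y)\<bar>"
  obtains j where "j \<in> {1..CARD('n)} - J"
    and "\<bar>\<bar>lam j\<bar> - \<bar>tensor_form (T + E) (\<lambda>_. y)\<bar>\<bar> \<le> tensor_op_norm E"
    and "min (norm (v j - y)) (norm (v j + y)) \<le> 3 * tensor_op_norm E / \<bar>lam j\<bar>"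
proof -
  define I where "I = {1..CARD('n)}"
  define P where "P = CARD('p)"
  define \<epsilon> where "\<epsilon> = tensor_op_norm E"
  define x where "x i = v i \<bullet> y" for i
  define S where "S = (\<Sum>i\<in>I. \<bar>lam i\<bar> * \<bar>x i\<bar> ^ P)"
  have fin: "finite I"
    by (simp add: I_def)
  have P: "3 \<le> P"
    using p by (simp add: P_def)
  have \<epsilon>0: "0 \<le> \<epsilon>"
    by (simp add: \<epsilon>_def tensor_op_norm_nonneg)
  have \<epsilon>\<theta>: "\<epsilon> \<le> 2 / 25 * (\<theta>\<^sup>2 * m)"
    using E by (simp add: \<epsilon>_def)
  have "\<theta>\<^sup>2 \<le> 1 / 4"
    using \<theta> power_mono[of \<theta> "1 / 2" 2] by (simp add: power2_eq_square)
  then have "\<theta>\<^sup>2 * m \<le> 1 / 4 * m"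
    using m(1) by (intro mult_right_mono) auto
  then have \<epsilon>50: "\<epsilon> \<le> m / 50"
    using \<epsilon>\<theta> by linarith
  have on: "v i \<bullet> v j = (if i = j then 1 else 0)" if "i \<in> I" "j \<in> I" for i j
    using basis that by (simp add: orthonormal_basis_def I_def)
  then have unit: "norm (v i) = 1" if "i \<in> I" for i
    using that by (simp add: norm_eq_1)
  have E_le: "\<bar>tensor_form E (\<lambda>_. z)\<bar> \<le> \<epsilon>" if "norm z = 1" for z
    using that abs_tensor_form_le_unit[of "\<lambda>_. z" E] by (simp add: \<epsilon>_def)
  have form_T: "tensor_form T (\<lambda>_. z) = (\<Sum>i\<in>I. lam i * (v i \<bullet> z) ^ P)" for z
    unfolding P_def I_def by (rule tensor_form_sum_powers[OF T])
  have form_v: "tensor_form T (\<lambda>_. v j) = lam j" if "j \<in> I" for j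
  proof -
    have "(\<Sum>i\<in>I. lam i * (v i \<bullet> v j) ^ P) = (\<Sum>i\<in>I. if i = j then lam i else 0)"
      using on that P by (intro sum.cong) auto
    then show ?thesis
      using that fin by (simp add: form_T)
  qed
  have parseval: "(\<Sum>i\<in>I. (x i)\<^sup>2) = 1"
    using orthonormal_basis_parseval[OF basis, of y] y by (simp add: I_def x_def)
  have x_le: "\<bar>x i\<bar> \<le> 1" if "i \<in> I" for i
    using Cauchy_Schwarz_ineq2[of "v i" y] unit[OF that] y by (simp add: x_def)
  \<comment> \<open>Since \<open>P - 2\<close> is at least 1, a factor of order
    \<open>\<theta>\<close> survives, and \<open>K * \<theta> \<le> m / 2\<close> absorbs the size
    of \<open>lam i\<close>.\<close>
  have pow_le: "\<bar>lam i\<bar> * \<bar>x i\<bar> ^ (P - 2) \<le> c * m / 2" if "i \<in> I" "\<bar>x i\<bar> \<le> c * \<theta>" for i c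
  proof -
    have "\<bar>lam i\<bar> * \<bar>x i\<bar> ^ (P - 2) \<le> K * (c * \<theta>)"
    proof (intro mult_mono)
      show "\<bar>x i\<bar> ^ (P - 2) \<le> c * \<theta>"
        using that(2) power_le_self_real[OF abs_ge_zero x_le[OF that(1)], of "P - 2"] P by linarith
    qed (use K[of i] that in \<open>auto simp: I_def\<close>)
    also have "\<dots> = c * (K * \<theta>)"
      by simp
    also have "\<dots> \<le> c * (m / 2)"
    proof (rule mult_left_mono[OF \<theta>(3)])
      have "0 \<le> c * \<theta>"
        using that(2) by linarith
      then show "0 \<le> c"
        using \<theta>(1) by (simp add: zero_le_mult_iff)
    qed
    finally show ?thesis by simp
  qed
  have "\<bar>tensor_form T (\<lambda>_. y)\<bar> \<le> S"
    unfolding form_T S_def x_def[symmetric]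
    by (rule order.trans[OF sum_abs]) (simp add: abs_mult power_abs)
  then have Fy: "\<bar>tensor_form (T + E) (\<lambda>_. y)\<bar> \<le> S + \<epsilon>"
    using E_le[OF y] by (simp add: tensor_form_add_left)
  have Fv: "\<bar>lam i\<bar> - \<epsilon> \<le> \<bar>tensor_form (T + E) (\<lambda>_. y)\<bar>" if "i \<in> I - J" for i
    using max[of i] that E_le[OF unit, of i] by (auto simp: I_def tensor_form_add_left form_v)
  \<comment> \<open>The threshold \<open>0.6 * m\<close> separates matched indices, which reach at
    most \<open>0.56 * m\<close>, from \<open>S\<close>, which is at least
    \<open>m - 2 * \<epsilon> \<ge> 0.96 * m\<close>.\<close>
  have "0.6 * m < S" if "i \<in> I - J" for i
    using Fv[OF that] Fy that m(2)[of i] m(1) \<epsilon>50 by (simp add: I_def)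
  moreover have "\<bar>lam i\<bar> * \<bar>x i\<bar> ^ (P - 2) \<le> 0.6 * m" if "i \<in> J" for i
    using pow_le[of i "1.12"] J that m(1) by (fastforce simp: x_def I_def)
  moreover have "I - J \<noteq> {}" "2 \<le> P"
    using J(1) P by (auto simp: I_def)
  ultimately obtain j where j: "j \<in> I - J" "S \<le> \<bar>lam j\<bar> * \<bar>x j\<bar> ^ (P - 2)"
    using dominant_coordinate[of I P x J lam "0.6 * m"] fin parseval unfolding S_def by blast
  define a where "a = \<bar>x j\<bar>"
  have jI: "j \<in> I"
    using j by simp
  have a: "0 \<le> a" "a \<le> 1"
    using x_le[OF jI] by (auto simp: a_def)
  have lam_j: "m \<le> \<bar>lam j\<bar>"
    using m jI by (simp add: I_def)
  have "\<bar>lam j\<bar> * a ^ (P - 2) \<le> \<bar>lam j\<bar> * 1"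
    using a by (intro mult_left_mono) (auto intro: power_le_one)
  then have "\<bar>\<bar>lam j\<bar> - \<bar>tensor_form (T + E) (\<lambda>_. y)\<bar>\<bar> \<le> \<epsilon>"
    using Fv[OF j(1)] Fy j(2) unfolding a_def by linarith
  moreover have "min (norm (v j - y)) (norm (v j + y)) \<le> 3 * \<epsilon> / \<bar>lam j\<bar>"
  proof -
    \<comment> \<open>Bootstrap: sandwiching \<open>S\<close> first gives a crude bound on
      \<open>1 - a\<close> of order \<open>\<theta>\<^sup>2\<close>. This makes all other
      coordinates small enough for \<open>distance_bound\<close> to yield an estimate linear in
      \<open>\<epsilon>\<close>.\<close>
    have "\<bar>lam j\<bar> * (1 - a ^ (P - 2)) \<le> 2 * \<epsilon>"
      using Fv[OF j(1)] Fy j(2) by (simp add: a_def algebra_simps)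
    also have "\<dots> \<le> 0.16 * \<theta>\<^sup>2 * m"
      using \<epsilon>\<theta> by (simp add: mult.commute)
    also have "\<dots> \<le> \<bar>lam j\<bar> * (0.16 * \<theta>\<^sup>2)"
      using mult_right_mono[OF lam_j, of "0.16 * \<theta>\<^sup>2"] by (simp add: mult_ac)
    finally have a_pow: "1 - a ^ (P - 2) \<le> 0.16 * \<theta>\<^sup>2"
      by (rule mult_left_le_imp_le) (use lam_j m(1) in simp)
    then have a_pow': "0.96 \<le> a ^ (P - 2)"
      using \<open>\<theta>\<^sup>2 \<le> 1 / 4\<close> by simp
    have a_pow_le: "a ^ (P - 2) \<le> a"
      using P by (intro power_le_self_real[OF a]) simp
    have "1 - a\<^sup>2 \<le> 2 * (1 - a)"
      using zero_le_power2[of "1 - a"] by (simp add: power2_eq_square algebra_simps)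
    also have "\<dots> \<le> 0.32 * \<theta>\<^sup>2"
      using a_pow a_pow_le by simp
    finally have a2: "1 - a\<^sup>2 \<le> 0.32 * \<theta>\<^sup>2" .
    have rest: "(\<Sum>i\<in>I - {j}. (x i)\<^sup>2) = 1 - a\<^sup>2"
      using parseval sum.remove[OF fin jI, of "\<lambda>i. (x i)\<^sup>2"] by (simp add: a_def)
    \<comment> \<open>By Parseval this covers the remaining unmatched indices too, about which the
      hypothesis on \<open>J\<close> says nothing.\<close>
    have "\<bar>x i\<bar> \<le> 0.6 * \<theta>" if "i \<in> I - {j}" for i
    proof -
      have "(x i)\<^sup>2 \<le> (\<Sum>i\<in>I - {j}. (x i)\<^sup>2)"
        using fin that by (intro member_le_sum) auto
      also have "\<dots> \<le> 0.32 * \<theta>\<^sup>2"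
        using a2 rest by simp
      also have "\<dots> \<le> (0.6 * \<theta>)\<^sup>2"
        by (simp add: power_mult_distrib power_divide)
      finally show ?thesis
        using \<theta>(1) abs_le_square_iff[of "x i" "0.6 * \<theta>"] by simp
    qed
    then have small: "\<bar>lam i\<bar> * \<bar>x i\<bar> ^ (P - 2) \<le> 0.3 * m" if "i \<in> I - {j}" for i
      using pow_le[of i "0.6"] that by simp
    define r where "r = (\<Sum>i\<in>I - {j}. lam i * x i ^ P)"
    have "\<bar>r\<bar> \<le> (\<Sum>i\<in>I - {j}. \<bar>lam i\<bar> * \<bar>x i\<bar> ^ P)"
      unfolding r_def by (rule order.trans[OF sum_abs]) (simp add: abs_mult power_abs)
    also have "\<dots> \<le> 0.3 * m * (1 - a\<^sup>2)"
      using sum_abs_power_le[of P "I - {j}" lam x, OF _ small] P by (simp add: rest)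
    also have "\<dots> \<le> 0.3 * \<bar>lam j\<bar> * (1 - a\<^sup>2)"
      using lam_j a by (intro mult_right_mono) (auto simp: power_le_one)
    finally have r: "\<bar>r\<bar> \<le> 0.3 * \<bar>lam j\<bar> * (1 - a\<^sup>2)" .
    \<comment> \<open>The sign \<open>s\<close> puts \<open>w\<close> on the side of
      \<open>y\<close>. For odd \<open>P\<close> it also flips the form, which \<open>t\<close>
      records.\<close>
    define s :: real where "s = (if x j \<ge> 0 then 1 else - 1)"
    define w where "w = s *\<^sub>R v j"
    define t where "t = s ^ P * lam j"
    have s: "\<bar>s\<bar> = 1" "x j = s * a"
      by (auto simp: s_def a_def)
    have t: "\<bar>t\<bar> = \<bar>lam j\<bar>"
      by (simp add: t_def abs_mult power_abs s)
    then have t0: "t \<noteq> 0"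
      using lam_j m(1) by linarith
    have w: "norm w = 1"
      by (simp add: w_def s unit[OF jI])
    have form_scale: "tensor_form B (\<lambda>_. w) = s ^ P * tensor_form B (\<lambda>_. v j)"
      for B :: "('p, 'n) tensor"
      unfolding w_def by (simp add: tensor_form_scaleR P_def)
    have Tw: "tensor_form T (\<lambda>_. w) = t"
      by (simp add: form_scale form_v jI t_def)
    have Ty: "tensor_form T (\<lambda>_. y) = t * a ^ P + r"
      unfolding form_T x_def[symmetric] r_def
      by (subst sum.remove[OF fin jI]) (simp add: s(2) t_def power_mult_distrib mult_ac)
    have "\<bar>tensor_form (T + E) (\<lambda>_. w)\<bar> \<le> \<bar>tensor_form (T + E) (\<lambda>_. y)\<bar>"
      using max[of j] j(1) by (simp add: form_scale abs_mult power_abs s I_def)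
    then have le: "\<bar>t + tensor_form E (\<lambda>_. w)\<bar> \<le> \<bar>t * a ^ P + r + tensor_form E (\<lambda>_. y)\<bar>"
      by (simp add: tensor_form_add_left Tw Ty)
    have "y \<bullet> w = s * x j"
      by (simp add: w_def x_def inner_commute)
    also have "\<dots> = a"
      by (simp add: s_def a_def)
    finally have "(norm (y - w))\<^sup>2 = 2 - 2 * a"
      using y w by (simp add: power2_norm_eq_inner inner_diff inner_commute norm_eq_1)
    then have "norm (y - w) \<le> 3 * \<epsilon> / \<bar>t\<bar>"
      using P a a_pow' t0 \<epsilon>0 \<epsilon>50 lam_j m(1) r le E_le[OF w]
        abs_tensor_form_diff_le[OF y w, of E]
      by (intro distance_bound[where p = P and a = a and r = r and
            ex = "tensor_form E (\<lambda>_. w)" and ey = "tensor_form E (\<lambda>_. y)"])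
         (auto simp: t P_def \<epsilon>_def)
    moreover have "min (norm (v j - y)) (norm (v j + y)) \<le> norm (y - w)"
      by (auto simp: w_def s_def norm_minus_commute add.commute)
    ultimately show ?thesis
      by (simp add: t)
  qed
  ultimately show thesis
    using that[of j] j(1) by (simp add: I_def \<epsilon>_def)
qed

section \<open>Induction over the steps and assembly of the permutation\<close>

theorem theorem4p1:
  fixes T E :: "('p::finite, 'n::finite) tensor"
    and lam lam_hat :: "nat \<Rightarrow> real"
    and v v_hat :: "nat \<Rightarrow> real ^ 'n"
    and \<theta> \<epsilon> \<kappa> lam_min lam_max :: real
  assumes p: "CARD('p) \<ge> 3"
    and T_sym: "symmetric_tensor T"
    and T_decomp: "T = (\<Sum>i=1..CARD('n). lam i *\<^sub>R tensor_power (v i))"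
    and v_basis: "orthonormal_basis v"
    and lam_nz: "\<forall>i\<in>{1..CARD('n)}. lam i \<noteq> 0"
    and E_sym: "symmetric_tensor E"
    and eps: "\<epsilon> = tensor_op_norm E"
    and lam_min: "lam_min = Min ((\<lambda>i. \<bar>lam i\<bar>) ` {1..CARD('n)})"
    and lam_max: "lam_max = Max ((\<lambda>i. \<bar>lam i\<bar>) ` {1..CARD('n)})"
    and kappa: "\<kappa> = lam_max / lam_min"
    and theta: "0 < \<theta>" "\<theta> \<le> 1 / (2 * \<kappa>)"
    and eps_le: "\<epsilon> \<le> \<theta>\<^sup>2 * lam_min / 12.5"
    and run: "SROAwCD_output (T + E) \<theta> lam_hat v_hat"
  shows "\<exists>\<pi>. \<pi> permutes {1..CARD('n)} \<and>
    (\<forall>j\<in>{1..CARD('n)}.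
       min \<bar>lam (\<pi> j) - lam_hat j\<bar> \<bar>lam (\<pi> j) + lam_hat j\<bar> \<le> \<epsilon> \<and>
       min (norm (v (\<pi> j) - v_hat j)) (norm (v (\<pi> j) + v_hat j))
         \<le> (6.2 + 4 * \<kappa>) * \<epsilon> / \<bar>lam (\<pi> j)\<bar>)"
proof -
  define I where "I = {1..CARD('n)}"
  have I: "finite I" "I \<noteq> {}"
    by (auto simp: I_def)
  have min_le: "lam_min \<le> \<bar>lam i\<bar>" and le_max: "\<bar>lam i\<bar> \<le> lam_max" if "i \<in> I" for i
    using that I by (auto simp: lam_min lam_max I_def)
  have min_pos: "0 < lam_min"
    using lam_nz by (simp add: lam_min Min_gr_iff)
  have \<kappa>: "1 \<le> \<kappa>"
    using I min_le le_max min_pos by (fastforce simp: kappa)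
  have \<theta>\<kappa>: "\<kappa> * \<theta> \<le> 1 / 2"
    using theta(2) \<kappa> by (simp add: field_simps)
  have "1 * \<theta> \<le> \<kappa> * \<theta>"
    using \<kappa> theta(1) by (intro mult_right_mono) auto
  then have \<theta>half: "\<theta> \<le> 1 / 2"
    using \<theta>\<kappa> by simp
  have \<theta>max: "lam_max * \<theta> \<le> lam_min / 2"
    using \<theta>\<kappa> min_pos by (simp add: kappa field_simps)
  have \<epsilon>0: "0 \<le> \<epsilon>"
    by (simp add: eps tensor_op_norm_nonneg)
  \<comment> \<open>The invariant uses the constant 3, free of \<open>\<kappa>\<close> and below
    \<open>6.2 + 4 * \<kappa>\<close>. Comparing absolute values of eigenvalues leaves the sign
    open.\<close>
  define near where "near k j \<longleftrightarrow> \<bar>\<bar>lam j\<bar> - \<bar>lam_hat k\<bar>\<bar> \<le> \<epsilon> \<and>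
    min (norm (v j - v_hat k)) (norm (v j + v_hat k)) \<le> 3 * \<epsilon> / \<bar>lam j\<bar>" for k j
  have near_sign: "\<exists>s. \<bar>s\<bar> = 1 \<and> norm (v j - s *\<^sub>R v_hat k) \<le> 0.12 * \<theta>"
    if "near k j" "j \<in> I" for k j
  proof -
    \<comment> \<open>One factor \<open>\<theta>\<close> of the bound on \<open>\<epsilon>\<close>
      is spent on \<open>\<theta> \<le> 1 / 2\<close>; the other keeps the error proportional to
      \<open>\<theta>\<close>.\<close>
    have "3 * \<epsilon> / \<bar>lam j\<bar> \<le> 3 * (\<theta>\<^sup>2 * lam_min / 12.5) / lam_min"
      using mult_left_mono[OF eps_le, of 3] \<epsilon>0 min_le[OF that(2)] min_pos
      by (intro frac_le) auto
    also have "\<dots> = 0.24 * \<theta> * \<theta>"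
      using min_pos by (simp add: power2_eq_square)
    also have "\<dots> \<le> 0.24 * \<theta> * (1 / 2)"
      using theta(1) \<theta>half by (intro mult_left_mono) auto
    finally have "3 * \<epsilon> / \<bar>lam j\<bar> \<le> 0.12 * \<theta>"
      by simp
    then have "min (norm (v j - v_hat k)) (norm (v j + v_hat k)) \<le> 0.12 * \<theta>"
      using that(1) unfolding near_def by linarith
    then have "norm (v j - 1 *\<^sub>R v_hat k) \<le> 0.12 * \<theta> \<or> norm (v j - (- 1) *\<^sub>R v_hat k) \<le> 0.12 * \<theta>"
      by (auto simp: min_le_iff_disj)
    then show ?thesis
      by (metis abs_minus_cancel abs_one)
  qed
  have near_inner: "\<bar>v j \<bullet> u\<bar> \<le> \<bar>v_hat k \<bullet> u\<bar> + 0.12 * \<theta>" "\<bar>v_hat k \<bullet> u\<bar> \<le> \<bar>v j \<bullet> u\<bar> + 0.12 * \<theta>"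
    if "near k j" "j \<in> I" "norm u = 1" for k j u
  proof -
    from near_sign[OF that(1,2)]
    obtain s where s: "\<bar>s\<bar> = 1" "norm (v j - s *\<^sub>R v_hat k) \<le> 0.12 * \<theta>"
      by blast
    have "\<bar>v j \<bullet> u - s * (v_hat k \<bullet> u)\<bar> \<le> 0.12 * \<theta>"
      using Cauchy_Schwarz_ineq2[of "v j - s *\<^sub>R v_hat k" u] s(2) that(3)
      by (simp add: inner_diff_left)
    moreover have "\<bar>s * (v_hat k \<bullet> u)\<bar> = \<bar>v_hat k \<bullet> u\<bar>"
      by (simp add: abs_mult s)
    ultimately show "\<bar>v j \<bullet> u\<bar> \<le> \<bar>v_hat k \<bullet> u\<bar> + 0.12 * \<theta>" "\<bar>v_hat k \<bullet> u\<bar> \<le> \<bar>v j \<bullet> u\<bar> + 0.12 * \<theta>"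
      by linarith+
  qed
  have on: "v i \<bullet> v j = (if i = j then 1 else 0)" if "i \<in> I" "j \<in> I" for i j
    using v_basis that by (simp add: orthonormal_basis_def I_def)
  have step: "\<exists>j\<in>I - f ` {1..<k}. near k j"
    if k: "k \<in> I" and f: "\<And>i. i \<in> {1..<k} \<Longrightarrow> f i \<in> I \<and> near i (f i)" for k f
  proof -
    note run_k = SROAwCD_output_maximizes[OF run k[unfolded I_def]]
    \<comment> \<open>Only \<open>k - 1 < n\<close> steps precede step \<open>k\<close>, so some
      index is still unmatched.\<close>
    have "card (f ` {1..<k}) < card I"
      using card_image_le[of "{1..<k}" f] k by (auto simp: I_def)
    then have psub: "f ` {1..<k} \<subset> I"
      using f by (metis image_subsetI psubsetI less_irrefl)
    have defl: "\<bar>v i \<bullet> v_hat k\<bar> \<le> 1.12 * \<theta>" if "i \<in> f ` {1..<k}" for i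
    proof -
      from that obtain l where l: "l \<in> {1..<k}" "i = f l"
        by blast
      show ?thesis
        using near_inner(1)[of l i "v_hat k"] f[OF l(1)] l run_k(1) run_k(2)[of l]
        by (simp add: inner_commute)
    qed
    \<comment> \<open>An unmatched \<open>v j\<close> is orthogonal to \<open>v (f i)\<close>, so
      its inner product with \<open>v_hat i\<close> is at most \<open>0.12 * \<theta>\<close>. For
      \<open>i = 0\<close> it vanishes because \<open>v_hat 0 = 0\<close>.\<close>
    have feas: "\<bar>v j \<bullet> v_hat i\<bar> \<le> \<theta>" if "j \<in> I - f ` {1..<k}" "i < k" for i j
    proof (cases "i = 0")
      case True
      then show ?thesis
        using run theta(1) by (simp add: SROAwCD_output_def)
    next
      case False
      then have i: "i \<in> {1..<k}"
        using that by simp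
      then have "f i \<noteq> j"
        using that by blast
      then show ?thesis
        using near_inner(2)[of i "f i" "v j"] f[OF i] that on theta(1)
        by (simp add: inner_commute norm_eq_1)
    qed
    have max: "\<bar>tensor_form (T + E) (\<lambda>_. v j)\<bar> \<le> \<bar>tensor_form (T + E) (\<lambda>_. v_hat k)\<bar>"
      if "j \<in> I - f ` {1..<k}" for j
      using that by (intro run_k(4) feas) (simp_all add: norm_eq_1 on)
    show ?thesis
      by (rule constrained_maximizer_near_basis[OF p T_decomp v_basis min_pos min_le[unfolded I_def]
            le_max[unfolded I_def] theta(1) \<theta>half \<theta>max eps_le[unfolded eps]
            psub[unfolded I_def] defl run_k(1) max[unfolded I_def]])
         (auto simp: near_def run_k(3) I_def eps)
  qed
  \<comment> \<open>The choice at \<open>k\<close> depends on all earlier choices, hence recursion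
    along the well-order. Values outside \<open>I\<close> are left free.\<close>
  have "\<exists>f. \<forall>k. k \<in> I \<longrightarrow> f k \<in> I - f ` {1..<k} \<and> near k (f k)"
  proof (rule dependent_wellorder_choice)
    show "(k \<in> I \<longrightarrow> r \<in> I - f ` {1..<k} \<and> near k r) = (k \<in> I \<longrightarrow> r \<in> I - g ` {1..<k} \<and> near k r)"
      if "\<And>y. y < k \<Longrightarrow> f y = g y" for r f g k
    proof -
      have "f ` {1..<k} = g ` {1..<k}"
        using that by (intro image_cong) auto
      then show ?thesis by simp
    qed
    show "\<exists>r. k \<in> I \<longrightarrow> r \<in> I - f ` {1..<k} \<and> near k r"
      if "\<And>y. y < k \<Longrightarrow> y \<in> I \<longrightarrow> f y \<in> I - f ` {1..<y} \<and> near y (f y)" for k f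
    proof (cases "k \<in> I")
      case True
      with that have "f i \<in> I \<and> near i (f i)" if "i \<in> {1..<k}" for i
        using that by (auto simp: I_def)
      from step[OF True this] show ?thesis by blast
    qed simp
  qed
  then obtain f where f: "\<And>k. k \<in> I \<Longrightarrow> f k \<in> I - f ` {1..<k} \<and> near k (f k)"
    by blast
  have "inj_on f I"
  proof (rule linorder_inj_onI)
    show "f i \<noteq> f k" if "i < k" "i \<in> I" "k \<in> I" for i k
    proof -
      have "f i \<in> f ` {1..<k}"
        using that by (intro imageI) (simp add: I_def)
      then show ?thesis
        using f[OF that(3)] by auto
    qed
  qed auto
  then have "bij_betw f I I"
    unfolding bij_betw_def using f by (simp add: endo_inj_surj[OF I(1)] image_subset_iff)
  \<comment> \<open>\<open>permutes\<close> requires the identity outside \<open>I\<close>.\<close>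
  define \<pi> where "\<pi> k = (if k \<in> I then f k else k)" for k
  have "bij_betw \<pi> I I"
    using \<open>bij_betw f I I\<close> by (rule bij_betw_cong[THEN iffD1, rotated]) (simp add: \<pi>_def)
  then have "\<pi> permutes I"
    by (rule bij_imp_permutes) (simp add: \<pi>_def)
  moreover have "min \<bar>lam (\<pi> j) - lam_hat j\<bar> \<bar>lam (\<pi> j) + lam_hat j\<bar> \<le> \<epsilon> \<and>
       min (norm (v (\<pi> j) - v_hat j)) (norm (v (\<pi> j) + v_hat j))
         \<le> (6.2 + 4 * \<kappa>) * \<epsilon> / \<bar>lam (\<pi> j)\<bar>" if "j \<in> I" for j
  proof -
    have near: "near j (\<pi> j)"
      using f[OF that] that by (simp add: \<pi>_def)
    have "3 * \<epsilon> / \<bar>lam (\<pi> j)\<bar> \<le> (6.2 + 4 * \<kappa>) * \<epsilon> / \<bar>lam (\<pi> j)\<bar>"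
      using \<kappa> \<epsilon>0 by (intro divide_right_mono mult_right_mono) auto
    moreover have "min \<bar>lam (\<pi> j) - lam_hat j\<bar> \<bar>lam (\<pi> j) + lam_hat j\<bar>
        \<le> \<bar>\<bar>lam (\<pi> j)\<bar> - \<bar>lam_hat j\<bar>\<bar>"
      by linarith
    ultimately show ?thesis
      using near by (auto simp: near_def)
  qed
  ultimately show ?thesis
    unfolding I_def by blast
qed

end
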